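(* Let $\mathcal{C}$ be the collection of all generalized shifts $\sigma_\psi:Y^\Gamma\to Y^\Gamma$ such that $Y$ is a nontrivial finite discrete topological group, $\Gamma$ is a nonempty set, and both maps $\psi:\Gamma\to\Gamma$ and $\sigma_\psi:Y^\Gamma\to Y^\Gamma$ are finite fibre. Let $\mathcal{C}_{\rm top}$, $\mathcal{C}_{\rm cset}$, $\mathcal{C}_{\rm set}$ be the collections of those $\sigma_\psi\in\mathcal{C}$ with $\mathrm{ent}_{\rm top}(\sigma_\psi)>0$, $\mathrm{ent}_{\rm cset}(\sigma_\psi)>0$, $\mathrm{ent}_{\rm set}(\sigma_\psi)>0$ respectively, and let $\mathcal{C}_{\rm dalg}$ be the collection of those $\sigma_\psi\in\mathcal{C}$ (with $Y$ abelian) with $\mathrm{ent}_{\rm alg}(\sigma_\psi\restriction_{\bigoplus_\Gamma Y})>0$. Then $\mathcal{C}_{\rm top}\subseteq\mathcal{C}_{\rm cset}\subseteq\mathcal{C}_{\rm set}$ and $\mathcal{C}_{\rm dalg}\subseteq\mathcal{C}_{\rm set}$. In fact, for every element $\sigma_\varphi:Y^\Gamma\to Y^\Gamma$ of $\mathcal{C}$, $$\mathrm{ent}_{\rm top}(\sigma_\varphi)\leq\mathrm{ent}_{\rm cset}(\sigma_\varphi)\leq\mathrm{ent}_{\rm set}(\sigma_\varphi),$$ and (with $Y$ abelian) $$\mathrm{ent}_{\rm alg}(\sigma_\varphi\restriction_{\bigoplus_\Gamma Y})\leq\mathrm{ent}_{\rm set}(\sigma_\varphi).$$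
   Context: The generalized shift of $\psi:\Gamma\to\Gamma$ is $\sigma_\psi((x_\alpha)_{\alpha\in\Gamma})=(x_{\psi(\alpha)})_{\alpha\in\Gamma}$. A map is finite fibre if the preimage of every point is finite. Set-theoretical entropy: for $g:A\to A$, $\mathrm{ent}_{\rm set}(g)=\sup_D\lim_{n\to\infty}\frac{|D\cup g(D)\cup\cdots\cup g^{n-1}(D)|}{n}$ over finite $D\subseteq A$. Contravariant set-theoretical entropy: for $g:A\to A$ onto and finite fibre, $\mathrm{ent}_{\rm cset}(g)=\sup_D\lim_{n\to\infty}\frac{|D\cup g^{-1}(D)\cup\cdots\cup g^{-(n-1)}(D)|}{n}$ over finite $D\subseteq A$; for an arbitrary finite fibre $k:A\to A$, $\mathrm{ent}_{\rm cset}(k):=\mathrm{ent}_{\rm cset}(k\restriction_{\mathrm{sc}(k)})$ where $\mathrm{sc}(k)=\bigcap\{k^n(A):n\geq1\}$ (on which $k$ restricts to an onto finite fibre self-map). Topological entropy: for a compact space $Z$ and continuous $T:Z\to Z$, $\mathrm{ent}_{\rm top}(T)=\sup_{\mathcal{U}}\lim_{n\to\infty}\frac{\log N(\mathcal{U}\vee T^{-1}(\mathcal{U})\vee\cdots\vee T^{-(n-1)}(\mathcal{U}))}{n}$ over finite open covers $\mathcal{U}$, where $\mathcal{U}\vee\mathcal{V}=\{U\cap V:U\in\mathcal{U},V\in\mathcal{V}\}$ and $N(\mathcal{U})$ is the minimal cardinality of a finite subcover of $\mathcal{U}$. Here $Y^\Gamma$ has the product topology. It is known that $\mathrm{ent}_{\rm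 top}(\sigma_\psi)=\mathrm{ent}_{\rm set}(\psi)\log|Y|$. Algebraic entropy: for an abelian group $G$ and endomorphism $\theta:G\to G$, $\mathrm{ent}_{\rm alg}(\theta)=\sup_H\lim_{n\to\infty}\frac{\log|H+\theta(H)+\cdots+\theta^{n-1}(H)|}{n}$ over finite subgroups $H$ of $G$. $\bigoplus_\Gamma Y$ is the subgroup of $Y^\Gamma$ of all families equal to the identity $e$ of $Y$ at all but finitely many indices; when $\psi$ is finite fibre it is mapped into itself by $\sigma_\psi$. It is known that for $\psi$ finite fibre, $\mathrm{ent}_{\rm alg}(\sigma_\psi\restriction_{\bigoplus_\Gamma Y})=\mathrm{ent}_{\rm cset}(\psi)\log|Y|$. *)

theory Defs
  imports "HOL-Analysis.Analysis" "HOL-Algebra.Product_Groups"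
begin

definition finite_fibre :: "'x set \<Rightarrow> ('x \<Rightarrow> 'x) \<Rightarrow> bool" where
  "finite_fibre A f \<longleftrightarrow> (\<forall>y\<in>A. finite {x \<in> A. f x = y})"

text \<open>
  All entropies are extended reals, and the limits are taken in \<^typ>\<open>ereal\<close>: for the
  contravariant entropy the limit may already be infinite for a single finite set \<open>D\<close>.
\<close>

definition ent_set :: "'x set \<Rightarrow> ('x \<Rightarrow> 'x) \<Rightarrow> ereal" where
  "ent_set A g =
    (SUP D \<in> {D. finite D \<and> D \<subseteq> A}.
      lim (\<lambda>n. ereal (real (card (\<Union>i<n. (g ^^ i) ` D)) / real n)))"

text \<open>Only meaningful when \<open>g\<close> maps \<open>A\<close> onto \<open>A\<close> with finite fibres.\<close>

definition ent_cset_onto :: "'x set \<Rightarrow> ('x \<Rightarrow> 'x) \<Rightarrow> ereal" where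
  "ent_cset_onto A g =
    (SUP D \<in> {D. finite D \<and> D \<subseteq> A}.
      lim (\<lambda>n. ereal (real (card (\<Union>i<n. {x \<in> A. (g ^^ i) x \<in> D})) / real n)))"

definition surj_core :: "'x set \<Rightarrow> ('x \<Rightarrow> 'x) \<Rightarrow> 'x set" where
  "surj_core A k = (\<Inter>n\<in>{1..}. (k ^^ n) ` A)"

definition ent_cset :: "'x set \<Rightarrow> ('x \<Rightarrow> 'x) \<Rightarrow> ereal" where
  "ent_cset A k = ent_cset_onto (surj_core A k) (restrict k (surj_core A k))"

definition finite_open_cover :: "'x topology \<Rightarrow> 'x set set \<Rightarrow> bool" where
  "finite_open_cover Z \<U> \<longleftrightarrow> finite \<U> \<and> (\<forall>U\<in>\<U>. openin Z U) \<and> \<Union>\<U> = topspace Z"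

definition cover_join :: "'x set set \<Rightarrow> 'x set set \<Rightarrow> 'x set set" where
  "cover_join \<U> \<V> = {U \<inter> V | U V. U \<in> \<U> \<and> V \<in> \<V>}"

definition cover_preimage :: "'x topology \<Rightarrow> ('x \<Rightarrow> 'x) \<Rightarrow> 'x set set \<Rightarrow> 'x set set" where
  "cover_preimage Z T \<U> = (\<lambda>U. {z \<in> topspace Z. T z \<in> U}) ` \<U>"

text \<open>
  The join of the first \<open>n\<close> preimages of \<open>\<U>\<close>; the initial value is neutral for the join
  of covers of \<open>Z\<close>.
\<close>

primrec cover_iter :: "'x topology \<Rightarrow> ('x \<Rightarrow> 'x) \<Rightarrow> 'x set set \<Rightarrow> nat \<Rightarrow> 'x set set" where
  "cover_iter Z T \<U> 0 = {topspace Z}"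
| "cover_iter Z T \<U> (Suc n) = cover_join (cover_iter Z T \<U> n) (cover_preimage Z (T ^^ n) \<U>)"

definition min_subcover :: "'x topology \<Rightarrow> 'x set set \<Rightarrow> nat" where
  "min_subcover Z \<U> =
    (LEAST m. \<exists>\<V>\<subseteq>\<U>. finite \<V> \<and> \<Union>\<V> = topspace Z \<and> card \<V> = m)"

definition ent_top :: "'x topology \<Rightarrow> ('x \<Rightarrow> 'x) \<Rightarrow> ereal" where
  "ent_top Z T =
    (SUP \<U> \<in> {\<U>. finite_open_cover Z \<U>}.
      lim (\<lambda>n. ereal (ln (real (min_subcover Z (cover_iter Z T \<U> n))) / real n)))"

text \<open>
  The sum of the first \<open>n\<close> images of \<open>H\<close>; groups are written multiplicatively, so the sum of
  subsets is \<open><#>\<close>.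
\<close>

primrec alg_traj :: "('x, 'm) monoid_scheme \<Rightarrow> ('x \<Rightarrow> 'x) \<Rightarrow> 'x set \<Rightarrow> nat \<Rightarrow> 'x set" where
  "alg_traj G \<theta> H 0 = {\<one>\<^bsub>G\<^esub>}"
| "alg_traj G \<theta> H (Suc n) = alg_traj G \<theta> H n <#>\<^bsub>G\<^esub> (\<theta> ^^ n) ` H"

definition ent_alg :: "('x, 'm) monoid_scheme \<Rightarrow> ('x \<Rightarrow> 'x) \<Rightarrow> ereal" where
  "ent_alg G \<theta> =
    (SUP H \<in> {H. subgroup H G \<and> finite H}.
      lim (\<lambda>n. ereal (ln (real (card (alg_traj G \<theta> H n))) / real n)))"

abbreviation power_space :: "'a monoid \<Rightarrow> 'i set \<Rightarrow> ('i \<Rightarrow> 'a) set" where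
  "power_space Y \<Gamma> \<equiv> (\<Pi>\<^sub>E \<alpha>\<in>\<Gamma>. carrier Y)"

abbreviation power_top :: "'a monoid \<Rightarrow> 'i set \<Rightarrow> ('i \<Rightarrow> 'a) topology" where
  "power_top Y \<Gamma> \<equiv> product_topology (\<lambda>_. discrete_topology (carrier Y)) \<Gamma>"

abbreviation direct_sum :: "'a monoid \<Rightarrow> 'i set \<Rightarrow> ('i \<Rightarrow> 'a) monoid" where
  "direct_sum Y \<Gamma> \<equiv> sum_group \<Gamma> (\<lambda>_. Y)"

definition gen_shift :: "'a monoid \<Rightarrow> 'i set \<Rightarrow> ('i \<Rightarrow> 'i) \<Rightarrow> ('i \<Rightarrow> 'a) \<Rightarrow> ('i \<Rightarrow> 'a)" where
  "gen_shift Y \<Gamma> \<psi> = (\<lambda>x\<in>power_space Y \<Gamma>. \<lambda>\<alpha>\<in>\<Gamma>. x (\<psi> \<alpha>))"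

text \<open>
  A generalized shift \<open>\<sigma> : Y\<^sup>\<Gamma> \<rightarrow> Y\<^sup>\<Gamma>\<close> is stored as \<open>(Y, \<Gamma>, \<sigma>)\<close>, i.e. as a
  map together with the data determining its domain and the group structure there. The type
  variables \<open>'a\<close> and \<open>'i\<close> bound the groups and index sets collected: the collection over all
  \<open>Y\<close> and \<open>\<Gamma>\<close> is a proper class.
\<close>

type_synonym ('a, 'i) shift = "'a monoid \<times> 'i set \<times> (('i \<Rightarrow> 'a) \<Rightarrow> ('i \<Rightarrow> 'a))"

definition shifts :: "('a, 'i) shift set" where
  "shifts = {(Y, \<Gamma>, gen_shift Y \<Gamma> \<psi>) | Y \<Gamma> \<psi>.
     group Y \<and> finite (carrier Y) \<and> \<not> trivial_group Y \<and> \<Gamma> \<noteq> {} \<and>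
     \<psi> \<in> \<Gamma> \<rightarrow> \<Gamma> \<and> finite_fibre \<Gamma> \<psi> \<and>
     finite_fibre (power_space Y \<Gamma>) (gen_shift Y \<Gamma> \<psi>)}"

definition shifts_top :: "('a, 'i) shift set" where
  "shifts_top = {(Y, \<Gamma>, \<sigma>) \<in> shifts. ent_top (power_top Y \<Gamma>) \<sigma> > 0}"

definition shifts_cset :: "('a, 'i) shift set" where
  "shifts_cset = {(Y, \<Gamma>, \<sigma>) \<in> shifts. ent_cset (power_space Y \<Gamma>) \<sigma> > 0}"

definition shifts_set :: "('a, 'i) shift set" where
  "shifts_set = {(Y, \<Gamma>, \<sigma>) \<in> shifts. ent_set (power_space Y \<Gamma>) \<sigma> > 0}"

definition shifts_dalg :: "('a, 'i) shift set" where
  "shifts_dalg = {(Y, \<Gamma>, \<sigma>) \<in> shifts. comm_group Y \<and>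
     ent_alg (direct_sum Y \<Gamma>) (restrict \<sigma> (carrier (direct_sum Y \<Gamma>))) > 0}"

end

theory Submission
  imports Defs "HOL-Real_Asymp.Real_Asymp"
begin

text \<open>
  Each inequality holds because the larger side is infinite unless the smaller side is zero, and
  which of the two happens depends on \<open>\<psi>\<close> only. Write \<open>\<sigma>\<close> for the generalized shift.

  Suppose first that \<open>\<psi>\<close> is eventually periodic, \<open>\<psi> ^^ (M + p) = \<psi> ^^ M\<close>. Then so is \<open>\<sigma>\<close>, which
  is hence a permutation of finite order on its core, and the contravariant entropy vanishes
  (\<open>ent_cset_gen_shift_eq_0\<close>). The iterates of \<open>\<sigma>\<close> move a finite set of finitely supported
  families inside a finite set, so the algebraic entropy vanishes too
  (\<open>ent_alg_gen_shift_le_0\<close>).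

  If \<open>\<psi>\<close> is not eventually periodic, the set-theoretical entropy is infinite
  (\<open>ent_set_gen_shift_eq_infinity\<close>): there are infinitely many points with infinite, pairwise
  disjoint \<open>\<sigma>\<close>-orbits. This is a genericity argument. For \<open>m \<noteq> n\<close> the iterates \<open>\<psi> ^^ m\<close> and
  \<open>\<psi> ^^ n\<close> differ at infinitely many indices (\<open>infinite_disagreement\<close>), and since \<open>\<psi>\<close> has finite
  fibres, fixing finitely many coordinates of a point never forces two of its iterates to agree.
  There are only countably many coincidences to avoid, and they are avoided one after the other
  (\<open>countable_separating_colouring\<close>). Points with infinite orbits and unbounded lengths of finite
  orbits are thus treated alike.

  For the topological entropy the relevant question is whether all \<open>\<psi>\<close>-orbits are finite. If they
  are, a finite open cover and all its iterated joins depend on one finite set of coordinates, and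
  the topological entropy vanishes (\<open>ent_top_gen_shift_le_0\<close>). If some index has an infinite orbit,
  the contravariant entropy is infinite (\<open>ent_cset_gen_shift_eq_infinity\<close>). Indeed the core of \<open>\<sigma>\<close>
  consists of the families that are constant on the classes of indices whose \<open>\<psi>\<close>-orbits merge
  (\<open>surj_core_gen_shift\<close>), and \<open>\<psi>\<close> is injective on these classes. If it is not surjective on them,
  all fibres of \<open>\<sigma>\<close> in the core have at least two points and preimages grow exponentially; if it
  is, \<open>\<sigma>\<close> permutes the core and infinitely many disjoint backward orbits are obtained from generic
  binary sequences placed along the infinite orbit.
\<close>

section \<open>Eventually periodic maps\<close>

text \<open>
  Preperiod \<open>M\<close> and period \<open>p\<close> are the same for all points of \<open>S\<close>; that every point of \<open>S\<close> has
  a finite orbit is expressed by singletons.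
\<close>
definition eventually_periodic_on :: "('a \<Rightarrow> 'a) \<Rightarrow> 'a set \<Rightarrow> bool" where
  "eventually_periodic_on f S \<longleftrightarrow> (\<exists>M p. 0 < p \<and> (\<forall>a\<in>S. (f ^^ (M + p)) a = (f ^^ M) a))"

lemma funpow_add_apply: "(f ^^ (m + n)) a = (f ^^ m) ((f ^^ n) a)"
  by (simp add: funpow_add)

lemma funpow_mem:
  assumes "f \<in> S \<rightarrow> S" "a \<in> S"
  shows "(f ^^ n) a \<in> S"
  using assms by (induction n) auto

lemma funpow_periodic_multiple:
  fixes f :: "'a \<Rightarrow> 'a"
  assumes "(f ^^ (M + p)) a = (f ^^ M) a" "M \<le> N"
  shows "(f ^^ (N + k * p)) a = (f ^^ N) a"
proof (induction k)
  case (Suc k)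
  obtain d where d: "N = d + M"
    using assms(2) by (metis add.commute le_iff_add)
  have "(f ^^ (N + Suc k * p)) a = (f ^^ ((d + k * p) + (M + p))) a"
    by (simp add: d algebra_simps)
  also have "\<dots> = (f ^^ ((d + k * p) + M)) a"
    by (simp only: funpow_add_apply[of "d + k * p" _ f] assms(1))
  also have "\<dots> = (f ^^ (N + k * p)) a"
    by (simp add: d algebra_simps)
  finally show ?case
    using Suc.IH by simp
qed simp

lemma eventually_periodic_on_Un:
  assumes "eventually_periodic_on f S" "eventually_periodic_on f T"
  shows "eventually_periodic_on f (S \<union> T)"
proof -
  obtain M p where S: "0 < p" "\<And>a. a \<in> S \<Longrightarrow> (f ^^ (M + p)) a = (f ^^ M) a"
    using assms(1) unfolding eventually_periodic_on_def by blast
  obtain N q where T: "0 < q" "\<And>a. a \<in> T \<Longrightarrow> (f ^^ (N + q)) a = (f ^^ N) a"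
    using assms(2) unfolding eventually_periodic_on_def by blast
  have "(f ^^ (max M N + p * q)) a = (f ^^ max M N) a" if "a \<in> S \<union> T" for a
    using that funpow_periodic_multiple[OF S(2), of a "max M N" q]
      funpow_periodic_multiple[OF T(2), of a "max M N" p]
    by (auto simp: mult.commute)
  then show ?thesis
    unfolding eventually_periodic_on_def using S(1) T(1) by (metis mult_pos_pos)
qed

lemma eventually_periodic_on_finite:
  assumes "finite S" "\<And>a. a \<in> S \<Longrightarrow> eventually_periodic_on f {a}"
  shows "eventually_periodic_on f S"
  using assms
proof (induction S rule: finite_induct)
  case empty
  then show ?case unfolding eventually_periodic_on_def by auto
next
  case (insert a S)
  then show ?case
    using eventually_periodic_on_Un[of f "{a}" S] by auto
qed

lemma inj_orbit_if_not_eventually_periodic: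
  assumes "\<not> eventually_periodic_on f {a}"
  shows "inj (\<lambda>i. (f ^^ i) a)"
proof (rule linorder_injI)
  fix i j :: nat
  assume "i < j"
  then have "j = i + (j - i)" "0 < j - i" by auto
  then show "(f ^^ i) a \<noteq> (f ^^ j) a"
    using assms unfolding eventually_periodic_on_def by (metis singletonD)
qed

lemma funpow_takes_finitely_many_values:
  assumes "eventually_periodic_on f S"
  obtains L where "\<And>n. \<exists>i<L. \<forall>a\<in>S. (f ^^ n) a = (f ^^ i) a"
proof -
  obtain M p where Mp: "0 < p" "\<And>a. a \<in> S \<Longrightarrow> (f ^^ (M + p)) a = (f ^^ M) a"
    using assms unfolding eventually_periodic_on_def by blast
  have "\<exists>i<M + p. \<forall>a\<in>S. (f ^^ n) a = (f ^^ i) a" for n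
  proof (cases "n < M")
    case True
    then show ?thesis by (intro exI[of _ n]) auto
  next
    case False
    let ?i = "M + (n - M) mod p"
    have "n = ?i + ((n - M) div p) * p"
      using False by (simp add: mult.commute)
    then have "(f ^^ n) a = (f ^^ ?i) a" if "a \<in> S" for a
      using funpow_periodic_multiple[OF Mp(2)[OF that], of ?i "(n - M) div p"] by simp
    moreover have "?i < M + p" using Mp(1) by simp
    ultimately show ?thesis by blast
  qed
  then show thesis using that by blast
qed

text \<open>
  A single index at which two iterates differ would not leave any freedom in the choice of
  families that the two iterates of the shift separate; infinitely many do.
  If the exceptional set were finite, then \<open>f\<close> would be eventually periodic on its complement;
  it cannot contain a point with infinite orbit, because all iterates of that point are
  exceptional as well, so \<open>f\<close> would be eventually periodic on the finite exceptional set too.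
\<close>
lemma infinite_disagreement:
  assumes f: "f \<in> S \<rightarrow> S" and not_ep: "\<not> eventually_periodic_on f S" and "m \<noteq> n"
  shows "infinite {a \<in> S. (f ^^ m) a \<noteq> (f ^^ n) a}" (is "infinite ?E")
proof
  assume fin: "finite ?E"
  have "eventually_periodic_on f {a}" if "a \<in> S" for a
  proof (rule ccontr)
    assume "\<not> eventually_periodic_on f {a}"
    then have inj: "inj (\<lambda>i. (f ^^ i) a)"
      by (rule inj_orbit_if_not_eventually_periodic)
    have "range (\<lambda>i. (f ^^ i) a) \<subseteq> ?E"
    proof clarify
      fix i
      have "(f ^^ (m + i)) a \<noteq> (f ^^ (n + i)) a"
        using injD[OF inj, of "m + i" "n + i"] \<open>m \<noteq> n\<close> by auto
      then show "(f ^^ i) a \<in> S \<and> (f ^^ m) ((f ^^ i) a) \<noteq> (f ^^ n) ((f ^^ i) a)"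
        using funpow_mem[OF f that] by (simp add: funpow_add_apply)
    qed
    then show False
      using fin inj finite_subset range_inj_infinite by blast
  qed
  then have "eventually_periodic_on f ?E"
    by (rule eventually_periodic_on_finite[OF fin]) blast
  moreover have "eventually_periodic_on f (S - ?E)"
  proof -
    have "min m n + (max m n - min m n) = max m n" "0 < max m n - min m n"
      using \<open>m \<noteq> n\<close> by auto
    moreover have "(f ^^ max m n) a = (f ^^ min m n) a" if "a \<in> S - ?E" for a
      using that by (cases "m < n") (simp_all add: max_def min_def)
    ultimately show ?thesis
      unfolding eventually_periodic_on_def by metis
  qed
  ultimately have "eventually_periodic_on f (?E \<union> (S - ?E))"
    by (rule eventually_periodic_on_Un)
  moreover have "?E \<union> (S - ?E) = S" by blast
  ultimately show False using not_ep by simp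
qed

lemma finite_funpow_vimage:
  assumes f: "f \<in> S \<rightarrow> S" and fib: "finite_fibre S f" and "finite F"
  shows "finite {a \<in> S. (f ^^ n) a \<in> F}"
proof (induction n)
  case 0
  then show ?case using \<open>finite F\<close> by (simp add: Collect_conj_eq)
next
  case (Suc n)
  have "{a \<in> S. (f ^^ Suc n) a \<in> F} = (\<Union>y\<in>{a \<in> S. (f ^^ n) a \<in> F}. {a \<in> S. f a = y})"
    using f by (auto simp: funpow_swap1)
  then show ?case
    using Suc fib unfolding finite_fibre_def by auto
qed

section \<open>Binary colourings with prescribed disagreements\<close>

text \<open>
  The constraints are treated one after the other. Each contributes an edge \<open>(u, v)\<close> whose
  end \<open>u\<close> has not been coloured yet, so \<open>u\<close> can be given the colour that \<open>v\<close> does not have.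
\<close>
lemma countable_separating_colouring:
  fixes R :: "'i \<Rightarrow> ('c \<times> 'c) set"
  assumes "countable I"
    and edge: "\<And>i F. i \<in> I \<Longrightarrow> finite F \<Longrightarrow> \<exists>u v. (u, v) \<in> R i \<and> u \<noteq> v \<and> u \<notin> F"
  shows "\<exists>x :: 'c \<Rightarrow> bool. \<forall>i\<in>I. \<exists>u v. (u, v) \<in> R i \<and> x u \<noteq> x v"
proof (cases "I = {}")
  case False
  define r where "r = (\<lambda>k. R (from_nat_into I k))"
  have "\<exists>s :: nat \<Rightarrow> 'c set \<times> ('c \<Rightarrow> bool). \<forall>k. finite (fst (s k)) \<and>
      (fst (s k) \<subseteq> fst (s (Suc k)) \<and> (\<forall>c\<in>fst (s k). snd (s (Suc k)) c = snd (s k) c) \<and>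
       (\<exists>u v. (u, v) \<in> r k \<and> u \<in> fst (s (Suc k)) \<and> v \<in> fst (s (Suc k))
          \<and> snd (s (Suc k)) u \<noteq> snd (s (Suc k)) v))"
  proof (rule dependent_nat_choice)
    show "\<exists>t :: 'c set \<times> ('c \<Rightarrow> bool). finite (fst t)"
      by (metis finite.emptyI fst_conv)
  next
    fix t :: "'c set \<times> ('c \<Rightarrow> bool)" and k :: nat
    assume fin: "finite (fst t)"
    obtain u v where uv: "(u, v) \<in> r k" "u \<noteq> v" "u \<notin> fst t"
      unfolding r_def using edge[OF from_nat_into[OF False] fin] by blast
    let ?t = "(insert u (insert v (fst t)), (snd t)(u := \<not> snd t v))"
    show "\<exists>t'. finite (fst t') \<and> (fst t \<subseteq> fst t' \<and> (\<forall>c\<in>fst t. snd t' c = snd t c) \<and>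
       (\<exists>u v. (u, v) \<in> r k \<and> u \<in> fst t' \<and> v \<in> fst t' \<and> snd t' u \<noteq> snd t' v))"
    proof (rule exI[of _ ?t], intro conjI)
      have "(u, v) \<in> r k \<and> u \<in> fst ?t \<and> v \<in> fst ?t \<and> snd ?t u \<noteq> snd ?t v"
        using uv by simp
      then show "\<exists>u v. (u, v) \<in> r k \<and> u \<in> fst ?t \<and> v \<in> fst ?t \<and> snd ?t u \<noteq> snd ?t v"
        by blast
    qed (use fin uv in auto)
  qed
  then obtain s :: "nat \<Rightarrow> 'c set \<times> ('c \<Rightarrow> bool)" where
    sub: "\<And>k. fst (s k) \<subseteq> fst (s (Suc k))" and
    agree: "\<And>k c. c \<in> fst (s k) \<Longrightarrow> snd (s (Suc k)) c = snd (s k) c" and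
    sep: "\<And>k. \<exists>u v. (u, v) \<in> r k \<and> u \<in> fst (s (Suc k)) \<and> v \<in> fst (s (Suc k))
          \<and> snd (s (Suc k)) u \<noteq> snd (s (Suc k)) v"
    by metis
  have stable: "c \<in> fst (s (k + d)) \<and> snd (s (k + d)) c = snd (s k) c" if "c \<in> fst (s k)" for c k d
    using that by (induction d) (use sub agree in auto)
  define x where "x c = snd (s (LEAST k. c \<in> fst (s k))) c" for c
  have x: "x c = snd (s k) c" if "c \<in> fst (s k)" for c k
  proof -
    let ?l = "LEAST k. c \<in> fst (s k)"
    have "c \<in> fst (s ?l)" "?l \<le> k"
      using that by (auto intro: LeastI Least_le)
    then show ?thesis
      unfolding x_def using stable[of c ?l "k - ?l"] by simp
  qed
  have "\<exists>u v. (u, v) \<in> R i \<and> x u \<noteq> x v" if "i \<in> I" for i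
  proof -
    obtain k where "from_nat_into I k = i"
      using from_nat_into_surj[OF assms(1) \<open>i \<in> I\<close>] by blast
    then show ?thesis
      using sep[of k] x[of _ "Suc k"] unfolding r_def by auto
  qed
  then show ?thesis by blast
qed simp

text \<open>
  All the \<open>x j\<close> are found at once, as one colouring of the pairs \<open>(j, q)\<close>. The requirement that
  \<open>x j\<close> moved by \<open>f ^^ m\<close> differs from \<open>x l\<close> moved by \<open>f ^^ n\<close> is one of countably many
  constraints, and the avoided finite set in the hypothesis makes room for satisfying it after
  finitely many colours have been fixed. The resulting points have infinite, pairwise disjoint
  orbits under the shift.
\<close>
lemma functions_with_distinct_shifts:
  fixes f :: "'q \<Rightarrow> 'q"
  assumes differ: "\<And>m n F. m \<noteq> n \<Longrightarrow> finite F \<Longrightarrow> \<exists>a\<in>Q. (f ^^ m) a \<notin> F \<and> (f ^^ m) a \<noteq> (f ^^ n) a"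
  obtains x :: "nat \<Rightarrow> 'q \<Rightarrow> bool" where
    "\<And>j l m n. (\<And>a. a \<in> Q \<Longrightarrow> x j ((f ^^ m) a) = x l ((f ^^ n) a)) \<Longrightarrow> j = l \<and> m = n"
proof -
  define R where "R = (\<lambda>(j, l, m, n). (\<lambda>a. ((j :: nat, (f ^^ m) a), (l :: nat, (f ^^ n) a))) ` Q)"
  define I :: "(nat \<times> nat \<times> nat \<times> nat) set" where "I = {(j, l, m, n). (j, m) \<noteq> (l, n)}"
  have "\<exists>z :: nat \<times> 'q \<Rightarrow> bool. \<forall>i\<in>I. \<exists>u v. (u, v) \<in> R i \<and> z u \<noteq> z v"
  proof (rule countable_separating_colouring)
    fix i and F :: "(nat \<times> 'q) set"
    assume "i \<in> I" "finite F"
    then obtain j l m n where i: "i = (j, l, m, n)" "(j, m) \<noteq> (l, n)"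
      by (auto simp: I_def)
    \<comment> \<open>For \<open>m = n\<close> the two cells of an edge lie in different rows \<open>j\<close> and \<open>l\<close>. Then only a fresh
      \<open>(f ^^ m) a\<close> is needed, and \<open>differ\<close> yields it for any second exponent.\<close>
    let ?n = "if m = n then Suc m else n"
    have "m \<noteq> ?n" by simp
    then obtain a where "a \<in> Q" "(f ^^ m) a \<notin> snd ` F" "(f ^^ m) a \<noteq> (f ^^ ?n) a"
      using differ[of m ?n "snd ` F"] finite_imageI[OF \<open>finite F\<close>, of snd] by blast
    then show "\<exists>u v. (u, v) \<in> R i \<and> u \<noteq> v \<and> u \<notin> F"
      unfolding i(1) R_def using i(2)
      by (intro exI[of _ "(j, (f ^^ m) a)"] exI[of _ "(l, (f ^^ n) a)"])
        (force split: if_splits)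
  qed simp
  then obtain z :: "nat \<times> 'q \<Rightarrow> bool" where
    z: "\<And>i. i \<in> I \<Longrightarrow> \<exists>u v. (u, v) \<in> R i \<and> z u \<noteq> z v" by blast
  have "j = l \<and> m = n" if "\<And>a. a \<in> Q \<Longrightarrow> z (j, (f ^^ m) a) = z (l, (f ^^ n) a)" for j l m n
  proof (rule ccontr)
    assume "\<not> (j = l \<and> m = n)"
    then have "(j, l, m, n) \<in> I" by (auto simp: I_def)
    from z[OF this] that show False by (auto simp: R_def)
  qed
  then show thesis using that[of "\<lambda>j q. z (j, q)"] by blast
qed

section \<open>Entropies that are zero or infinite\<close>

text \<open>
  The operator \<open>lim\<close> is unspecified on divergent sequences. All bounds below therefore rest on
  sequences whose limit is determined: bounded counts, exactly linear ones, and exponential ones.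
\<close>

lemma lim_bounded_over_n:
  fixes b :: "nat \<Rightarrow> real"
  assumes "\<And>n. 0 \<le> b n" "\<And>n. b n \<le> B"
  shows "lim (\<lambda>n. ereal (b n / real n)) = 0"
proof -
  have "(\<lambda>n. b n / real n) \<longlonglongrightarrow> 0"
  proof (rule tendsto_sandwich[of "\<lambda>_. 0" _ _ "\<lambda>n. B / real n"])
    show "(\<lambda>n. B / real n) \<longlonglongrightarrow> 0" by (rule lim_const_over_n)
  qed (use assms in \<open>auto intro!: always_eventually divide_right_mono\<close>)
  then show ?thesis
    by (intro limI) (simp add: zero_ereal_def)
qed

lemma lim_card_over_n_if_finite_bound:
  assumes "finite T" "\<And>n. C n \<subseteq> T"
  shows "lim (\<lambda>n. ereal (real (card (C n)) / real n)) = 0"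
  using assms by (intro lim_bounded_over_n[of _ "real (card T)"]) (auto intro: card_mono)

lemma ent_set_nonneg: "0 \<le> ent_set A g"
  unfolding ent_set_def
  by (rule SUP_upper2[of "{}"]) (use lim_card_over_n_if_finite_bound[of "{}"] in auto)

lemma ent_cset_nonneg: "0 \<le> ent_cset A g"
  unfolding ent_cset_def ent_cset_onto_def
  by (rule SUP_upper2[of "{}"]) (use lim_card_over_n_if_finite_bound[of "{}"] in auto)

text \<open>The first \<open>k\<close> of the orbits contribute a finite set whose trajectory grows with rate \<open>k\<close>.\<close>
lemma ent_set_eq_infinity:
  fixes x :: "nat \<Rightarrow> 'x"
  assumes "range x \<subseteq> A"
    and inj: "\<And>j l m n. (g ^^ m) (x j) = (g ^^ n) (x l) \<Longrightarrow> j = l \<and> m = n"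
  shows "ent_set A g = \<infinity>"
proof -
  have "ereal (real k) \<le> ent_set A g" for k
  proof -
    have card: "card (\<Union>i<n. (g ^^ i) ` x ` {..<k}) = k * n" for n
    proof -
      have "(\<Union>i<n. (g ^^ i) ` x ` {..<k}) = (\<lambda>(j, i). (g ^^ i) (x j)) ` ({..<k} \<times> {..<n})"
        by force
      moreover have "inj_on (\<lambda>(j, i). (g ^^ i) (x j)) ({..<k} \<times> {..<n})"
        using inj by (fastforce intro: inj_onI)
      ultimately show ?thesis by (simp add: card_image)
    qed
    have "(\<lambda>n. ereal (real (k * n) / real n)) \<longlonglongrightarrow> ereal (real k)"
    proof (rule tendsto_eventually)
      show "\<forall>\<^sub>F n in sequentially. ereal (real (k * n) / real n) = ereal (real k)"
        using eventually_gt_at_top[of 0] by eventually_elim simp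
    qed
    then have "lim (\<lambda>n. ereal (real (card (\<Union>i<n. (g ^^ i) ` x ` {..<k})) / real n)) = ereal (real k)"
      unfolding card by (rule limI)
    then show ?thesis
      unfolding ent_set_def using assms(1)
      by (intro SUP_upper2[of "x ` {..<k}"]) auto
  qed
  then show ?thesis
    by (intro ereal_top) (meson ereal_less_eq(3) order_trans real_arch_simple)
qed

lemma funpow_right_inverse:
  assumes "h \<in> A \<rightarrow> A" "\<And>x. x \<in> A \<Longrightarrow> g (h x) = x" "x \<in> A"
  shows "(g ^^ n) ((h ^^ n) x) = x"
proof (induction n)
  case (Suc n)
  have "(g ^^ Suc n) ((h ^^ Suc n) x) = (g ^^ n) (g (h ((h ^^ n) x)))"
    by (simp add: funpow_swap1)
  also have "\<dots> = x"
    using Suc assms(2)[OF funpow_mem[OF assms(1,3)]] by simp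
  finally show ?case .
qed simp

lemma ent_cset_onto_bij:
  assumes "bij_betw g A A"
  shows "ent_cset_onto A g = ent_set A (inv_into A g)"
proof -
  let ?h = "inv_into A g"
  have g: "g \<in> A \<rightarrow> A" and h: "?h \<in> A \<rightarrow> A"
    using bij_betw_imp_funcset[OF assms] bij_betw_imp_funcset[OF bij_betw_inv_into[OF assms]] by auto
  have gh: "(g ^^ i) ((?h ^^ i) x) = x" and hg: "(?h ^^ i) ((g ^^ i) x) = x" if "x \<in> A" for x i
    using that funpow_right_inverse[OF h, of g] funpow_right_inverse[OF g, of ?h]
      bij_betw_inv_into_right[OF assms] bij_betw_inv_into_left[OF assms] by auto
  have "{x \<in> A. (g ^^ i) x \<in> D} = (?h ^^ i) ` D" if "D \<subseteq> A" for D i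
  proof
    show "{x \<in> A. (g ^^ i) x \<in> D} \<subseteq> (?h ^^ i) ` D"
      using hg by (metis (no_types, lifting) image_eqI mem_Collect_eq subsetI)
    show "(?h ^^ i) ` D \<subseteq> {x \<in> A. (g ^^ i) x \<in> D}"
      using that gh funpow_mem[OF h] by auto
  qed
  then show ?thesis
    unfolding ent_cset_onto_def ent_set_def by (intro SUP_cong) auto
qed

text \<open>
  Applying \<open>g ^^ (m + n)\<close> carries a coincidence of backward orbits over to one of forward orbits.
\<close>
lemma ent_cset_onto_eq_infinity_bij:
  fixes x :: "nat \<Rightarrow> 'x"
  assumes bij: "bij_betw g A A" and x: "range x \<subseteq> A"
    and inj: "\<And>j l m n. (g ^^ m) (x j) = (g ^^ n) (x l) \<Longrightarrow> j = l \<and> m = n"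
  shows "ent_cset_onto A g = \<infinity>"
  unfolding ent_cset_onto_bij[OF bij]
proof (rule ent_set_eq_infinity[OF x])
  let ?h = "inv_into A g"
  fix j l m n
  assume eq: "(?h ^^ m) (x j) = (?h ^^ n) (x l)"
  have h: "?h \<in> A \<rightarrow> A"
    using bij_betw_imp_funcset[OF bij_betw_inv_into[OF bij]] .
  have gh: "(g ^^ i) ((?h ^^ i) (x r)) = x r" for i r
    using x by (intro funpow_right_inverse[OF h]) (auto intro: bij_betw_inv_into_right[OF bij])
  have "(g ^^ n) (x j) = (g ^^ (n + m)) ((?h ^^ m) (x j))"
    by (simp add: funpow_add_apply gh)
  also have "\<dots> = (g ^^ (m + n)) ((?h ^^ n) (x l))"
    by (simp add: eq add.commute)
  also have "\<dots> = (g ^^ m) (x l)"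
    by (simp add: funpow_add_apply gh)
  finally show "j = l \<and> m = n"
    using inj by blast
qed

lemma ent_cset_onto_eq_infinity_fibres:
  assumes g: "g \<in> A \<rightarrow> A" and fib: "finite_fibre A g" and "A \<noteq> {}"
    and two: "\<And>y. y \<in> A \<Longrightarrow> 2 \<le> card {x \<in> A. g x = y}"
  shows "ent_cset_onto A g = \<infinity>"
proof -
  obtain y where y: "y \<in> A" using \<open>A \<noteq> {}\<close> by blast
  define B where "B n = {x \<in> A. (g ^^ n) x \<in> {y}}" for n
  have fin: "finite (B n)" for n
    unfolding B_def by (rule finite_funpow_vimage[OF g fib]) simp
  have card: "2 ^ n \<le> card (B n)" for n
  proof (induction n)
    case 0
    have "B 0 = {y}" using y by (auto simp: B_def)
    then show ?case by simp
  next
    case (Suc n)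
    have "B (Suc n) = (\<Union>z\<in>B n. {x \<in> A. g x = z})"
      using g by (auto simp: B_def funpow_swap1)
    also have "card \<dots> = (\<Sum>z\<in>B n. card {x \<in> A. g x = z})"
      using fin fib by (intro card_UN_disjoint) (auto simp: B_def finite_fibre_def)
    also have "\<dots> \<ge> (\<Sum>z\<in>B n. 2)"
      using two by (intro sum_mono) (auto simp: B_def)
    finally show ?case using Suc by simp
  qed
  let ?c = "\<lambda>n. card (\<Union>i<n. B i)"
  have le: "2 ^ n / (2 * real n) \<le> real (?c n) / real n" if "0 < n" for n
  proof -
    have "card (B (n - 1)) \<le> ?c n"
      using that fin by (intro card_mono) (auto intro!: bexI[of _ "n - 1"])
    then have "2 ^ (n - 1) \<le> ?c n"
      using card[of "n - 1"] by linarith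
    then have "(2 :: real) ^ (n - 1) \<le> real (?c n)"
      using of_nat_mono[of "2 ^ (n - 1)" "?c n", where 'a = real] by simp
    moreover have "(2 :: real) ^ n = 2 * 2 ^ (n - 1)"
      using that by (cases n) auto
    ultimately show ?thesis
      using that by (simp add: divide_right_mono)
  qed
  have "filterlim (\<lambda>n. real (?c n) / real n) at_top sequentially"
  proof (rule filterlim_at_top_mono)
    show "filterlim (\<lambda>n. 2 ^ n / (2 * real n)) at_top sequentially" by real_asymp
    show "\<forall>\<^sub>F n in sequentially. 2 ^ n / (2 * real n) \<le> real (?c n) / real n"
      using eventually_gt_at_top[of 0] by eventually_elim (rule le)
  qed
  then have "lim (\<lambda>n. ereal (real (?c n) / real n)) = \<infinity>"
    by (intro limI) (simp add: tendsto_PInfty_eq_at_top)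
  moreover have "lim (\<lambda>n. ereal (real (?c n) / real n)) \<le> ent_cset_onto A g"
    unfolding ent_cset_onto_def B_def using y by (intro SUP_upper) auto
  ultimately show ?thesis by simp
qed

text \<open>
  Surjectivity turns \<open>g ^^ (M + p) = g ^^ M\<close> into \<open>g ^^ p = id\<close> on \<open>A\<close>. Hence the preimages of
  a point under iterates of \<open>g\<close> lie on its finite forward orbit.
\<close>
lemma ent_cset_onto_eq_0:
  assumes surj: "g ` A = A" and ep: "eventually_periodic_on g A"
  shows "ent_cset_onto A g = 0"
proof -
  obtain M p where p: "0 < p" and Mp: "\<And>a. a \<in> A \<Longrightarrow> (g ^^ (M + p)) a = (g ^^ M) a"
    using ep unfolding eventually_periodic_on_def by blast
  obtain L where L: "\<And>n. \<exists>i<L. \<forall>a\<in>A. (g ^^ n) a = (g ^^ i) a"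
    using funpow_takes_finitely_many_values[OF ep] by metis
  have onto: "(g ^^ M) ` A = A"
  proof (induction M)
    case (Suc M)
    then show ?case using surj by (metis funpow.simps(2) image_comp)
  qed simp
  have id: "(g ^^ (0 + p)) a = (g ^^ 0) a" if "a \<in> A" for a
  proof -
    have "a \<in> (g ^^ M) ` A" using that onto by simp
    then obtain z where z: "z \<in> A" "a = (g ^^ M) z" by (rule imageE)
    have "(g ^^ p) a = (g ^^ (M + p)) z"
      unfolding z(2) funpow_add_apply[symmetric] by (simp only: add.commute)
    also have "\<dots> = a" unfolding z(2) by (rule Mp[OF z(1)])
    finally show ?thesis by simp
  qed
  have sub: "(\<Union>i<n. {x \<in> A. (g ^^ i) x \<in> D}) \<subseteq> (\<Union>j<L. (g ^^ j) ` D)" if "D \<subseteq> A" for D n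
  proof clarify
    fix x i
    assume x: "x \<in> A" "(g ^^ i) x \<in> D"
    have "x = (g ^^ ((i * p - i) + i)) x"
      using funpow_periodic_multiple[OF id[OF x(1)], of 0 i] p by simp
    also have "\<dots> = (g ^^ (i * p - i)) ((g ^^ i) x)" by (rule funpow_add_apply)
    finally have "x = (g ^^ (i * p - i)) ((g ^^ i) x)" .
    then show "x \<in> (\<Union>j<L. (g ^^ j) ` D)"
      using L[of "i * p - i"] x that by (metis UN_I image_eqI lessThan_iff subsetD)
  qed
  have "lim (\<lambda>n. ereal (real (card (\<Union>i<n. {x \<in> A. (g ^^ i) x \<in> D})) / real n)) = 0"
    if "finite D" "D \<subseteq> A" for D
    using that sub by (intro lim_card_over_n_if_finite_bound[of "\<Union>j<L. (g ^^ j) ` D"]) auto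
  moreover have "{} \<in> {D. finite D \<and> D \<subseteq> A}" by simp
  ultimately show ?thesis
    unfolding ent_cset_onto_def by (intro SUP_eq_const) auto
qed

section \<open>The surjective core of a generalized shift\<close>

lemma funpow_restrict:
  assumes "k \<in> S \<rightarrow> S" "x \<in> S"
  shows "(restrict k S ^^ n) x = (k ^^ n) x"
  using funpow_mem[OF assms] by (induction n) auto

lemma gen_shift_apply:
  "x \<in> power_space Y \<Gamma> \<Longrightarrow> gen_shift Y \<Gamma> \<psi> x = (\<lambda>\<alpha>\<in>\<Gamma>. x (\<psi> \<alpha>))"
  by (simp add: gen_shift_def)

lemma gen_shift_mem:
  assumes "\<psi> \<in> \<Gamma> \<rightarrow> \<Gamma>"
  shows "gen_shift Y \<Gamma> \<psi> \<in> power_space Y \<Gamma> \<rightarrow> power_space Y \<Gamma>"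
  using assms by (auto simp: gen_shift_apply PiE_iff Pi_iff)

lemma funpow_gen_shift:
  assumes "\<psi> \<in> \<Gamma> \<rightarrow> \<Gamma>" "x \<in> power_space Y \<Gamma>"
  shows "(gen_shift Y \<Gamma> \<psi> ^^ n) x = (\<lambda>\<alpha>\<in>\<Gamma>. x ((\<psi> ^^ n) \<alpha>))"
proof (induction n)
  case 0
  show ?case using assms(2) by (auto simp: PiE_iff extensional_def)
next
  case (Suc n)
  have "(gen_shift Y \<Gamma> \<psi> ^^ n) x \<in> power_space Y \<Gamma>"
    by (rule funpow_mem[OF gen_shift_mem[OF assms(1)] assms(2)])
  then have "(gen_shift Y \<Gamma> \<psi> ^^ Suc n) x = (\<lambda>\<alpha>\<in>\<Gamma>. (gen_shift Y \<Gamma> \<psi> ^^ n) x (\<psi> \<alpha>))"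
    by (simp add: gen_shift_apply)
  also have "\<dots> = (\<lambda>\<alpha>\<in>\<Gamma>. x ((\<psi> ^^ Suc n) \<alpha>))"
    using assms(1) by (auto simp: Suc.IH funpow_swap1 restrict_def fun_eq_iff)
  finally show ?case .
qed

lemma eventually_periodic_on_gen_shift:
  assumes "\<psi> \<in> \<Gamma> \<rightarrow> \<Gamma>" "eventually_periodic_on \<psi> \<Gamma>"
  shows "eventually_periodic_on (gen_shift Y \<Gamma> \<psi>) (power_space Y \<Gamma>)"
proof -
  obtain M p where "0 < p" "\<And>a. a \<in> \<Gamma> \<Longrightarrow> (\<psi> ^^ (M + p)) a = (\<psi> ^^ M) a"
    using assms(2) unfolding eventually_periodic_on_def by blast
  then show ?thesis
    unfolding eventually_periodic_on_def
    by (intro exI[of _ M] exI[of _ p]) (auto simp: funpow_gen_shift[OF assms(1)])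
qed

text \<open>
  The equivalence relation whose classes are the indices that a family in the core cannot
  distinguish.
\<close>
definition merging :: "('i \<Rightarrow> 'i) \<Rightarrow> 'i \<Rightarrow> 'i \<Rightarrow> bool" where
  "merging \<psi> a b \<longleftrightarrow> (\<exists>n. (\<psi> ^^ n) a = (\<psi> ^^ n) b)"

lemma merging_refl: "merging \<psi> a a"
  by (simp add: merging_def)

lemma merging_sym: "merging \<psi> a b \<Longrightarrow> merging \<psi> b a"
  unfolding merging_def by metis

lemma merging_trans:
  assumes "merging \<psi> a b" "merging \<psi> b c"
  shows "merging \<psi> a c"
proof -
  obtain m n where "(\<psi> ^^ m) a = (\<psi> ^^ m) b" "(\<psi> ^^ n) b = (\<psi> ^^ n) c"
    using assms unfolding merging_def by blast
  then have "(\<psi> ^^ (n + m)) a = (\<psi> ^^ (n + m)) c"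
    by (metis add.commute funpow_add_apply)
  then show ?thesis unfolding merging_def by blast
qed

lemma merging_image_iff: "merging \<psi> (\<psi> a) (\<psi> b) \<longleftrightarrow> merging \<psi> a b"
proof
  assume "merging \<psi> (\<psi> a) (\<psi> b)"
  then obtain n where "(\<psi> ^^ Suc n) a = (\<psi> ^^ Suc n) b"
    unfolding merging_def by (auto simp: funpow_swap1)
  then show "merging \<psi> a b" unfolding merging_def by blast
next
  assume "merging \<psi> a b"
  then obtain n where "(\<psi> ^^ n) a = (\<psi> ^^ n) b"
    unfolding merging_def by blast
  then have "\<psi> ((\<psi> ^^ n) a) = \<psi> ((\<psi> ^^ n) b)" by simp
  then show "merging \<psi> (\<psi> a) (\<psi> b)"
    unfolding merging_def by (auto simp: funpow_swap1)
qed

text \<open>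
  A family in the image of the \<open>n\<close>-th iterate cannot tell apart two indices with the same
  \<open>n\<close>-th iterate, and conversely such a family can be pulled back by choosing one index in
  each fibre of \<open>\<psi> ^^ n\<close>. The core is therefore a full power over the set of merging classes,
  on which \<open>\<psi>\<close> induces an injective map.
\<close>
lemma surj_core_gen_shift:
  assumes \<psi>: "\<psi> \<in> \<Gamma> \<rightarrow> \<Gamma>" and "group Y"
  shows "surj_core (power_space Y \<Gamma>) (gen_shift Y \<Gamma> \<psi>) =
    {y \<in> power_space Y \<Gamma>. \<forall>a\<in>\<Gamma>. \<forall>b\<in>\<Gamma>. merging \<psi> a b \<longrightarrow> y a = y b}" (is "?S = ?R")
proof
  let ?X = "power_space Y \<Gamma>" and ?\<sigma> = "gen_shift Y \<Gamma> \<psi>"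
  show "?S \<subseteq> ?R"
  proof
    fix y assume y: "y \<in> ?S"
    have img: "\<exists>x\<in>?X. y = (\<lambda>\<alpha>\<in>\<Gamma>. x ((\<psi> ^^ Suc n) \<alpha>))" for n
    proof -
      have "y \<in> (?\<sigma> ^^ Suc n) ` ?X"
        using y unfolding surj_core_def by (rule INT_D) simp
      then show ?thesis
        using funpow_gen_shift[OF \<psi>] by (auto simp del: funpow.simps)
    qed
    have "y a = y b" if "a \<in> \<Gamma>" "b \<in> \<Gamma>" "merging \<psi> a b" for a b
    proof -
      obtain n where "(\<psi> ^^ n) a = (\<psi> ^^ n) b"
        using \<open>merging \<psi> a b\<close> unfolding merging_def by blast
      then have "(\<psi> ^^ Suc n) a = (\<psi> ^^ Suc n) b" by simp
      moreover obtain x where "y = (\<lambda>\<alpha>\<in>\<Gamma>. x ((\<psi> ^^ Suc n) \<alpha>))" using img by blast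
      ultimately show ?thesis using that by (simp del: funpow.simps)
    qed
    moreover have "y \<in> ?X"
    proof -
      obtain x where x: "x \<in> ?X" "y = (\<lambda>\<alpha>\<in>\<Gamma>. x ((\<psi> ^^ Suc 0) \<alpha>))"
        using img[of 0] by blast
      show ?thesis
        unfolding x(2) restrict_PiE_iff using PiE_mem[OF x(1)] funpow_mem[OF \<psi>] by blast
    qed
    ultimately show "y \<in> ?R" by blast
  qed
  show "?R \<subseteq> ?S"
  proof
    fix y assume y: "y \<in> ?R"
    have "y \<in> (?\<sigma> ^^ n) ` ?X" for n
    proof
      let ?pick = "\<lambda>c. SOME a. a \<in> \<Gamma> \<and> (\<psi> ^^ n) a = c"
      let ?x = "\<lambda>c\<in>\<Gamma>. if \<exists>a\<in>\<Gamma>. (\<psi> ^^ n) a = c then y (?pick c) else \<one>\<^bsub>Y\<^esub>"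
      have pick: "?pick c \<in> \<Gamma> \<and> (\<psi> ^^ n) (?pick c) = c" if "\<exists>a\<in>\<Gamma>. (\<psi> ^^ n) a = c" for c
        using someI_ex[of "\<lambda>a. a \<in> \<Gamma> \<and> (\<psi> ^^ n) a = c"] that by auto
      show x: "?x \<in> ?X"
      proof (rule PiE_I)
        fix b assume "b \<in> \<Gamma>"
        show "?x b \<in> carrier Y"
        proof (cases "\<exists>a\<in>\<Gamma>. (\<psi> ^^ n) a = b")
          case True
          have "y \<in> ?X" using y by simp
          from this conjunct1[OF pick[OF True]] have "y (?pick b) \<in> carrier Y"
            by (rule PiE_mem)
          then show ?thesis using True \<open>b \<in> \<Gamma>\<close> by simp
        next
          case False
          then show ?thesis
            using \<open>b \<in> \<Gamma>\<close> \<open>group Y\<close> by (simp add: group.is_monoid monoid.one_closed)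
        qed
      qed simp
      have "?x ((\<psi> ^^ n) a) = y a" if "a \<in> \<Gamma>" for a
      proof -
        have "\<exists>a'\<in>\<Gamma>. (\<psi> ^^ n) a' = (\<psi> ^^ n) a" using that by blast
        moreover from pick[OF this] have "y (?pick ((\<psi> ^^ n) a)) = y a"
          using y that unfolding merging_def by blast
        ultimately show ?thesis using funpow_mem[OF \<psi> that] by simp
      qed
      then show "y = (?\<sigma> ^^ n) ?x"
        unfolding funpow_gen_shift[OF \<psi> x] using y
        by (auto simp: PiE_iff extensional_def fun_eq_iff)
    qed
    then show "y \<in> ?S" unfolding surj_core_def by blast
  qed
qed

text \<open>
  The value of a preimage is forced on the classes that meet the image of \<open>\<psi>\<close> and free on the
  others, where it is taken to be \<open>c\<close>.
\<close>
lemma gen_shift_preimage_in_core: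
  assumes \<psi>: "\<psi> \<in> \<Gamma> \<rightarrow> \<Gamma>" and "group Y"
    and y: "y \<in> surj_core (power_space Y \<Gamma>) (gen_shift Y \<Gamma> \<psi>)" and c: "c \<in> carrier Y"
  obtains z where "z \<in> surj_core (power_space Y \<Gamma>) (gen_shift Y \<Gamma> \<psi>)"
    "gen_shift Y \<Gamma> \<psi> z = y"
    "\<And>b. b \<in> \<Gamma> \<Longrightarrow> \<nexists>a. a \<in> \<Gamma> \<and> merging \<psi> (\<psi> a) b \<Longrightarrow> z b = c"
proof -
  let ?X = "power_space Y \<Gamma>" and ?\<sigma> = "gen_shift Y \<Gamma> \<psi>"
  note core = surj_core_gen_shift[OF \<psi> \<open>group Y\<close>]
  let ?P = "\<lambda>b a. a \<in> \<Gamma> \<and> merging \<psi> (\<psi> a) b"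
  define z where "z = (\<lambda>b\<in>\<Gamma>. if \<exists>a. ?P b a then y (SOME a. ?P b a) else c)"
  have yX: "y \<in> ?X" and y_eq: "\<And>a b. a \<in> \<Gamma> \<Longrightarrow> b \<in> \<Gamma> \<Longrightarrow> merging \<psi> a b \<Longrightarrow> y a = y b"
    using y unfolding core by blast+
  have z_eq: "z b = y a" if "b \<in> \<Gamma>" "?P b a" for a b
  proof -
    have some: "?P b (SOME a. ?P b a)" using that(2) by (rule someI)
    then have "merging \<psi> (\<psi> (SOME a. ?P b a)) (\<psi> a)"
      using that(2) merging_trans merging_sym by metis
    then have "y (SOME a. ?P b a) = y a"
      using y_eq some that(2) by (simp add: merging_image_iff)
    then show ?thesis using that by (auto simp: z_def)
  qed
  have z_c: "z b = c" if "b \<in> \<Gamma>" "\<nexists>a. ?P b a" for b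
    using that by (auto simp: z_def)
  have zX: "z \<in> ?X"
  proof (rule PiE_I)
    fix b assume "b \<in> \<Gamma>"
    then show "z b \<in> carrier Y"
      using z_eq[of b] z_c[of b] yX c by (metis PiE_mem)
  qed (simp add: z_def)
  have "z b = z b'" if "b \<in> \<Gamma>" "b' \<in> \<Gamma>" "merging \<psi> b b'" for b b'
  proof (cases "\<exists>a. ?P b a")
    case True
    then obtain a where "?P b a" by blast
    moreover from this have "?P b' a" using that(3) merging_trans by metis
    ultimately show ?thesis using z_eq that by metis
  next
    case False
    then have "\<nexists>a. ?P b' a" using that(3) merging_trans merging_sym by metis
    then show ?thesis using False z_c that by metis
  qed
  then have "z \<in> surj_core ?X ?\<sigma>" unfolding core using zX by blast
  moreover have "?\<sigma> z = y"
  proof -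
    have "z (\<psi> a) = y a" if "a \<in> \<Gamma>" for a
      using that \<psi> by (intro z_eq) (auto simp: merging_refl)
    then show ?thesis
      using yX by (auto simp: gen_shift_apply[OF zX] PiE_iff extensional_def fun_eq_iff)
  qed
  ultimately show thesis using that z_c by blast
qed

lemma gen_shift_image_core:
  assumes \<psi>: "\<psi> \<in> \<Gamma> \<rightarrow> \<Gamma>" and "group Y"
  shows "gen_shift Y \<Gamma> \<psi> ` surj_core (power_space Y \<Gamma>) (gen_shift Y \<Gamma> \<psi>) =
    surj_core (power_space Y \<Gamma>) (gen_shift Y \<Gamma> \<psi>)" (is "?\<sigma> ` ?S = ?S")
proof
  note core = surj_core_gen_shift[OF \<psi> \<open>group Y\<close>]
  show "?\<sigma> ` ?S \<subseteq> ?S"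
  proof clarify
    fix x assume x: "x \<in> ?S"
    then have "x \<in> power_space Y \<Gamma>" unfolding core by blast
    moreover have "x (\<psi> a) = x (\<psi> b)" if "a \<in> \<Gamma>" "b \<in> \<Gamma>" "merging \<psi> a b" for a b
    proof -
      have "\<psi> a \<in> \<Gamma>" "\<psi> b \<in> \<Gamma>" using \<psi> that by auto
      then show ?thesis
        using x that(3) unfolding core merging_image_iff[of \<psi> a b, symmetric] by blast
    qed
    ultimately show "?\<sigma> x \<in> ?S"
      unfolding core using funcset_mem[OF gen_shift_mem[OF \<psi>, of Y], of x]
      by (simp add: gen_shift_apply)
  qed
  show "?S \<subseteq> ?\<sigma> ` ?S"
  proof
    fix y assume "y \<in> ?S"
    then show "y \<in> ?\<sigma> ` ?S"
      using gen_shift_preimage_in_core[OF \<psi> \<open>group Y\<close>, of y "\<one>\<^bsub>Y\<^esub>"]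
        monoid.one_closed[OF group.is_monoid[OF \<open>group Y\<close>]] by (metis image_eqI)
  qed
qed

section \<open>Set-theoretical and contravariant entropy of a generalized shift\<close>

lemma ent_set_gen_shift_eq_infinity:
  assumes \<psi>: "\<psi> \<in> \<Gamma> \<rightarrow> \<Gamma>" and fib: "finite_fibre \<Gamma> \<psi>" and "group Y"
    and nontriv: "g \<in> carrier Y" "g \<noteq> \<one>\<^bsub>Y\<^esub>" and not_ep: "\<not> eventually_periodic_on \<psi> \<Gamma>"
  shows "ent_set (power_space Y \<Gamma>) (gen_shift Y \<Gamma> \<psi>) = \<infinity>"
proof -
  let ?X = "power_space Y \<Gamma>" and ?\<sigma> = "gen_shift Y \<Gamma> \<psi>"
  have "\<exists>a\<in>\<Gamma>. (\<psi> ^^ m) a \<notin> F \<and> (\<psi> ^^ m) a \<noteq> (\<psi> ^^ n) a" if "m \<noteq> n" "finite F" for m n F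
  proof -
    have "infinite ({a \<in> \<Gamma>. (\<psi> ^^ m) a \<noteq> (\<psi> ^^ n) a} - {a \<in> \<Gamma>. (\<psi> ^^ m) a \<in> F})"
      using infinite_disagreement[OF \<psi> not_ep \<open>m \<noteq> n\<close>] finite_funpow_vimage[OF \<psi> fib \<open>finite F\<close>]
      by (metis Diff_infinite_finite)
    then have "{a \<in> \<Gamma>. (\<psi> ^^ m) a \<noteq> (\<psi> ^^ n) a} - {a \<in> \<Gamma>. (\<psi> ^^ m) a \<in> F} \<noteq> {}"
      by (metis finite.emptyI)
    then show ?thesis by blast
  qed
  then obtain c :: "nat \<Rightarrow> 'a \<Rightarrow> bool" where
    c: "\<And>j l m n. (\<And>a. a \<in> \<Gamma> \<Longrightarrow> c j ((\<psi> ^^ m) a) = c l ((\<psi> ^^ n) a)) \<Longrightarrow> j = l \<and> m = n"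
    using functions_with_distinct_shifts[of \<Gamma> \<psi>] by metis
  define x where "x j = (\<lambda>a\<in>\<Gamma>. if c j a then g else \<one>\<^bsub>Y\<^esub>)" for j
  have x: "x j \<in> ?X" for j
    using nontriv(1) monoid.one_closed[OF group.is_monoid[OF \<open>group Y\<close>]] by (auto simp: x_def)
  show ?thesis
  proof (rule ent_set_eq_infinity[of x])
    show "range x \<subseteq> ?X" using x by blast
    fix j l m n
    assume eq: "(?\<sigma> ^^ m) (x j) = (?\<sigma> ^^ n) (x l)"
    show "j = l \<and> m = n"
    proof (rule c)
      fix a assume a: "a \<in> \<Gamma>"
      have "x j ((\<psi> ^^ m) a) = x l ((\<psi> ^^ n) a)"
        using fun_cong[OF eq, of a] a by (simp add: funpow_gen_shift[OF \<psi> x])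
      then show "c j ((\<psi> ^^ m) a) = c l ((\<psi> ^^ n) a)"
        using nontriv(2) funpow_mem[OF \<psi> a] by (auto simp: x_def split: if_splits)
    qed
  qed
qed

lemma ent_cset_gen_shift_eq_0:
  assumes \<psi>: "\<psi> \<in> \<Gamma> \<rightarrow> \<Gamma>" and "group Y" and ep: "eventually_periodic_on \<psi> \<Gamma>"
  shows "ent_cset (power_space Y \<Gamma>) (gen_shift Y \<Gamma> \<psi>) = 0"
proof -
  let ?\<sigma> = "gen_shift Y \<Gamma> \<psi>"
  let ?S = "surj_core (power_space Y \<Gamma>) ?\<sigma>"
  note img = gen_shift_image_core[OF \<psi> \<open>group Y\<close>]
  have "?S \<subseteq> power_space Y \<Gamma>"
    using surj_core_gen_shift[OF \<psi> \<open>group Y\<close>] by blast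
  moreover have "(restrict ?\<sigma> ?S ^^ n) x = (?\<sigma> ^^ n) x" if "x \<in> ?S" for n x
    using img that by (intro funpow_restrict) auto
  moreover obtain M p where "0 < p"
    "\<And>x. x \<in> power_space Y \<Gamma> \<Longrightarrow> (?\<sigma> ^^ (M + p)) x = (?\<sigma> ^^ M) x"
    using eventually_periodic_on_gen_shift[OF \<psi> ep, of Y]
    unfolding eventually_periodic_on_def by blast
  ultimately have "eventually_periodic_on (restrict ?\<sigma> ?S) ?S"
    unfolding eventually_periodic_on_def
    by (intro exI[of _ M] exI[of _ p] conjI ballI) (simp_all add: subsetD)
  then show ?thesis
    unfolding ent_cset_def using img by (intro ent_cset_onto_eq_0) simp_all
qed

text \<open>
  If some class misses the image of \<open>\<psi>\<close>, then every point of the core has at least two preimages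
  there and the trajectories of preimages grow exponentially. Otherwise the shift permutes the
  core, and on the classes of the infinite orbit of \<open>\<alpha>\<close>, which are pairwise distinct, it acts as
  the one-sided shift on sequences.
\<close>
lemma ent_cset_gen_shift_eq_infinity:
  assumes \<psi>: "\<psi> \<in> \<Gamma> \<rightarrow> \<Gamma>" and "group Y"
    and nontriv: "g \<in> carrier Y" "g \<noteq> \<one>\<^bsub>Y\<^esub>"
    and fib: "finite_fibre (power_space Y \<Gamma>) (gen_shift Y \<Gamma> \<psi>)"
    and \<alpha>: "\<alpha> \<in> \<Gamma>" and not_ep: "\<not> eventually_periodic_on \<psi> {\<alpha>}"
  shows "ent_cset (power_space Y \<Gamma>) (gen_shift Y \<Gamma> \<psi>) = \<infinity>"
proof -
  let ?X = "power_space Y \<Gamma>" and ?\<sigma> = "gen_shift Y \<Gamma> \<psi>"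
  let ?S = "surj_core ?X ?\<sigma>"
  let ?r = "restrict ?\<sigma> ?S"
  note core = surj_core_gen_shift[OF \<psi> \<open>group Y\<close>]
  note img = gen_shift_image_core[OF \<psi> \<open>group Y\<close>]
  have one: "\<one>\<^bsub>Y\<^esub> \<in> carrier Y"
    using \<open>group Y\<close> by (simp add: group.is_monoid monoid.one_closed)
  have SX: "?S \<subseteq> ?X" unfolding core by blast
  have \<sigma>S: "?\<sigma> \<in> ?S \<rightarrow> ?S" using img by auto
  show ?thesis
  proof (cases "\<exists>b\<in>\<Gamma>. \<nexists>a. a \<in> \<Gamma> \<and> merging \<psi> (\<psi> a) b")
    case True
    then obtain b where b: "b \<in> \<Gamma>" "\<nexists>a. a \<in> \<Gamma> \<and> merging \<psi> (\<psi> a) b" by blast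
    have "finite {x \<in> ?S. ?r x = y}" if "y \<in> ?S" for y
      using fib SX that unfolding finite_fibre_def
      by (intro finite_subset[of "{x \<in> ?S. ?r x = y}" "{x \<in> ?X. ?\<sigma> x = y}"]) auto
    then have fin: "finite_fibre ?S ?r" unfolding finite_fibre_def by blast
    have two: "2 \<le> card {x \<in> ?S. ?r x = y}" if y: "y \<in> ?S" for y
    proof -
      obtain z where z: "z \<in> ?S" "?\<sigma> z = y" "z b = \<one>\<^bsub>Y\<^esub>"
        using gen_shift_preimage_in_core[OF \<psi> \<open>group Y\<close> y one] b by metis
      obtain z' where z': "z' \<in> ?S" "?\<sigma> z' = y" "z' b = g"
        using gen_shift_preimage_in_core[OF \<psi> \<open>group Y\<close> y nontriv(1)] b by metis
      have "card {z, z'} \<le> card {x \<in> ?S. ?r x = y}"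
        using fin y z z' unfolding finite_fibre_def by (intro card_mono) auto
      moreover have "z \<noteq> z'" using z(3) z'(3) nontriv(2) by auto
      ultimately show ?thesis by simp
    qed
    have "(\<lambda>_\<in>\<Gamma>. \<one>\<^bsub>Y\<^esub>) \<in> ?S" unfolding core using one by auto
    then show ?thesis
      unfolding ent_cset_def using fin two \<sigma>S
      by (intro ent_cset_onto_eq_infinity_fibres) auto
  next
    case False
    have "inj_on ?\<sigma> ?S"
    proof (rule inj_onI)
      fix y z assume y: "y \<in> ?S" and z: "z \<in> ?S" and eq: "?\<sigma> y = ?\<sigma> z"
      have same: "y b = z b" if b: "b \<in> \<Gamma>" for b
      proof -
        obtain a where a: "a \<in> \<Gamma>" "merging \<psi> (\<psi> a) b" using False b by blast
        have "\<psi> a \<in> \<Gamma>" using \<psi> a(1) by blast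
        then have "y b = y (\<psi> a)" "z (\<psi> a) = z b"
          using y z a(2) b unfolding core by auto
        moreover have "y (\<psi> a) = z (\<psi> a)"
          using fun_cong[OF eq, of a] subsetD[OF SX y] subsetD[OF SX z] a(1)
          by (simp add: gen_shift_apply)
        ultimately show ?thesis by simp
      qed
      show "y = z"
        by (rule PiE_ext[OF subsetD[OF SX y] subsetD[OF SX z] same])
    qed
    then have bij: "bij_betw ?r ?S ?S"
      using img by (simp add: bij_betw_def inj_on_restrict_eq)
    have "\<exists>a\<in>UNIV. (Suc ^^ m) a \<notin> F \<and> (Suc ^^ m) a \<noteq> (Suc ^^ n) a"
      if "m \<noteq> n" "finite F" for m n F
    proof -
      obtain k where "F \<subseteq> {..<k}" using \<open>finite F\<close> finite_nat_iff_bounded by blast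
      then have "m + k \<notin> F" by auto
      then show ?thesis using \<open>m \<noteq> n\<close> by (intro bexI[of _ k]) (auto simp: Suc_funpow)
    qed
    then obtain c :: "nat \<Rightarrow> nat \<Rightarrow> bool" where
      c: "\<And>j l m n. (\<And>i. i \<in> UNIV \<Longrightarrow> c j ((Suc ^^ m) i) = c l ((Suc ^^ n) i)) \<Longrightarrow> j = l \<and> m = n"
      using functions_with_distinct_shifts[of UNIV Suc] by metis
    have inj: "inj (\<lambda>i. (\<psi> ^^ i) \<alpha>)"
      using not_ep by (rule inj_orbit_if_not_eventually_periodic)
    have classes: "i = i'" if "merging \<psi> ((\<psi> ^^ i) \<alpha>) ((\<psi> ^^ i') \<alpha>)" for i i'
    proof -
      obtain n where "(\<psi> ^^ (n + i)) \<alpha> = (\<psi> ^^ (n + i')) \<alpha>"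
        using \<open>merging _ _ _\<close> unfolding merging_def funpow_add_apply by blast
      then show ?thesis using injD[OF inj, of "n + i" "n + i'"] by simp
    qed
    define y where
      "y j = (\<lambda>b\<in>\<Gamma>. if \<exists>i. c j i \<and> merging \<psi> b ((\<psi> ^^ i) \<alpha>) then g else \<one>\<^bsub>Y\<^esub>)" for j
    have y_S: "y j \<in> ?S" for j
    proof -
      have "y j a = y j b" if "a \<in> \<Gamma>" "b \<in> \<Gamma>" "merging \<psi> a b" for a b
      proof -
        have "merging \<psi> a d \<longleftrightarrow> merging \<psi> b d" for d
          using that(3) merging_trans merging_sym by metis
        then show ?thesis using that by (simp add: y_def)
      qed
      moreover have "y j \<in> ?X" using one nontriv(1) by (auto simp: y_def)
      ultimately show ?thesis unfolding core by blast
    qed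
    have y_orbit: "y j ((\<psi> ^^ i) \<alpha>) = (if c j i then g else \<one>\<^bsub>Y\<^esub>)" for j i
    proof -
      have "(\<exists>i'. c j i' \<and> merging \<psi> ((\<psi> ^^ i) \<alpha>) ((\<psi> ^^ i') \<alpha>)) \<longleftrightarrow> c j i"
        using classes merging_refl by metis
      then show ?thesis using funpow_mem[OF \<psi> \<alpha>] by (simp add: y_def)
    qed
    show ?thesis
      unfolding ent_cset_def
    proof (rule ent_cset_onto_eq_infinity_bij[OF bij])
      show "range y \<subseteq> ?S" using y_S by blast
      fix j l m n
      assume "(?r ^^ m) (y j) = (?r ^^ n) (y l)"
      then have eq: "(?\<sigma> ^^ m) (y j) = (?\<sigma> ^^ n) (y l)"
        by (simp add: funpow_restrict[OF \<sigma>S y_S])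
      have y_X: "y j \<in> ?X" for j using y_S SX by blast
      show "j = l \<and> m = n"
      proof (rule c)
        fix i :: nat
        have "y j ((\<psi> ^^ (m + i)) \<alpha>) = y l ((\<psi> ^^ (n + i)) \<alpha>)"
          using fun_cong[OF eq, of "(\<psi> ^^ i) \<alpha>"] funpow_mem[OF \<psi> \<alpha>, of i]
          by (simp add: funpow_gen_shift[OF \<psi> y_X] funpow_add_apply)
        then show "c j ((Suc ^^ m) i) = c l ((Suc ^^ n) i)"
          using nontriv(2) unfolding y_orbit by (auto simp: Suc_funpow split: if_splits)
      qed
    qed
  qed
qed

section \<open>Topological entropy of a generalized shift\<close>

lemma lim_ln_over_n_if_bounded:
  fixes c :: "nat \<Rightarrow> nat"
  assumes "\<And>n. c n \<le> B"
  shows "lim (\<lambda>n. ereal (ln (real (c n)) / real n)) = 0"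
proof (rule lim_bounded_over_n)
  show "0 \<le> ln (real (c n))" for n
    by (cases "c n = 0") auto
  show "ln (real (c n)) \<le> real B" for n
  proof (cases "c n = 0")
    case False
    then have "ln (real (c n)) \<le> real (c n)" by (intro ln_bound) simp
    then show ?thesis using assms[of n] by (meson of_nat_mono order_trans)
  qed simp
qed

text \<open>
  By compactness finitely many basic boxes, each contained in a member of the cover, suffice to
  cover the power; together they constrain finitely many coordinates only.
\<close>
lemma finite_open_cover_power_top:
  assumes fin: "finite (carrier Y)" and cover: "finite_open_cover (power_top Y \<Gamma>) \<U>"
  obtains F where "finite F" "F \<subseteq> \<Gamma>"
    "\<And>x. x \<in> power_space Y \<Gamma> \<Longrightarrow>
      \<exists>U\<in>\<U>. \<forall>z\<in>power_space Y \<Gamma>. (\<forall>a\<in>F. z a = x a) \<longrightarrow> z \<in> U"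
proof -
  let ?X = "power_space Y \<Gamma>" and ?Z = "power_top Y \<Gamma>"
  have top: "topspace ?Z = ?X" by simp
  define supp where "supp W = {i \<in> \<Gamma>. W i \<noteq> carrier Y}" for W :: "'b \<Rightarrow> 'a set"
  define \<B> where "\<B> = {W. finite (supp W) \<and> (\<forall>i\<in>\<Gamma>. W i \<subseteq> carrier Y) \<and> (\<exists>U\<in>\<U>. Pi\<^sub>E \<Gamma> W \<subseteq> U)}"
  have box: "\<exists>W\<in>\<B>. x \<in> Pi\<^sub>E \<Gamma> W" if x: "x \<in> ?X" for x
  proof -
    obtain U where U: "U \<in> \<U>" "x \<in> U" "openin ?Z U"
      using cover x unfolding finite_open_cover_def top by blast
    then obtain W where W: "finite {i \<in> \<Gamma>. W i \<noteq> carrier Y}" "\<forall>i\<in>\<Gamma>. W i \<subseteq> carrier Y"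
        "x \<in> Pi\<^sub>E \<Gamma> W" "Pi\<^sub>E \<Gamma> W \<subseteq> U"
      unfolding openin_product_topology_alt by auto
    then show ?thesis using U(1) unfolding \<B>_def supp_def by blast
  qed
  have "compact_space ?Z"
    using fin by (simp add: compact_space_product_topology compact_space_discrete_topology)
  moreover have "\<forall>V\<in>Pi\<^sub>E \<Gamma> ` \<B>. openin ?Z V"
    unfolding \<B>_def supp_def by (auto simp: openin_PiE_gen)
  moreover have "?X \<subseteq> \<Union>(Pi\<^sub>E \<Gamma> ` \<B>)"
    using box by blast
  ultimately have "\<exists>\<F>. finite \<F> \<and> \<F> \<subseteq> Pi\<^sub>E \<Gamma> ` \<B> \<and> ?X \<subseteq> \<Union>\<F>"
    unfolding compact_space_def compactin_def top by blast
  then obtain \<W> where \<W>: "finite \<W>" "\<W> \<subseteq> \<B>" "?X \<subseteq> \<Union>(Pi\<^sub>E \<Gamma> ` \<W>)"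
    by (metis finite_subset_image)
  show thesis
  proof
    let ?F = "\<Union>(supp ` \<W>)"
    show "finite ?F" using \<W> unfolding \<B>_def by blast
    show "?F \<subseteq> \<Gamma>" unfolding supp_def by blast
    fix x assume "x \<in> ?X"
    then obtain W where W: "W \<in> \<W>" "x \<in> Pi\<^sub>E \<Gamma> W" using \<W>(3) by blast
    then obtain U where U: "U \<in> \<U>" "Pi\<^sub>E \<Gamma> W \<subseteq> U" using \<W>(2) unfolding \<B>_def by blast
    have same_box: "z \<in> Pi\<^sub>E \<Gamma> W" if z: "z \<in> ?X" "\<forall>a\<in>?F. z a = x a" for z
    proof (rule PiE_I)
      fix i assume i: "i \<in> \<Gamma>"
      show "z i \<in> W i"
      proof (cases "i \<in> supp W")
        case True
        then have "z i = x i" using z(2) W(1) by blast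
        then show ?thesis using W(2) i by (simp add: PiE_mem)
      next
        case False
        then have "W i = carrier Y" using i unfolding supp_def by blast
        then show ?thesis using PiE_mem[OF z(1) i] by simp
      qed
    qed (use z(1) in \<open>auto simp: PiE_iff extensional_def\<close>)
    show "\<exists>U\<in>\<U>. \<forall>z\<in>?X. (\<forall>a\<in>?F. z a = x a) \<longrightarrow> z \<in> U"
      by (intro bexI[OF _ U(1)] ballI impI subsetD[OF U(2)] same_box) blast+
  qed
qed

lemma cover_iter_subset_topspace:
  "V \<in> cover_iter Z T \<U> n \<Longrightarrow> V \<subseteq> topspace Z"
  by (induction n arbitrary: V) (auto simp: cover_join_def)

lemma cover_iter_invariant_coordinates:
  assumes \<psi>: "\<psi> \<in> \<Gamma> \<rightarrow> \<Gamma>" and orbits: "\<And>a n. a \<in> F \<Longrightarrow> (\<psi> ^^ n) a \<in> K" and "F \<subseteq> \<Gamma>"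
    and local: "\<And>x. x \<in> power_space Y \<Gamma> \<Longrightarrow>
      \<exists>U\<in>\<U>. \<forall>z\<in>power_space Y \<Gamma>. (\<forall>a\<in>F. z a = x a) \<longrightarrow> z \<in> U"
    and x: "x \<in> power_space Y \<Gamma>"
  shows "\<exists>V\<in>cover_iter (power_top Y \<Gamma>) (gen_shift Y \<Gamma> \<psi>) \<U> n.
    \<forall>z\<in>power_space Y \<Gamma>. (\<forall>a\<in>K. z a = x a) \<longrightarrow> z \<in> V"
proof (induction n)
  case 0
  show ?case by simp
next
  case (Suc n)
  let ?X = "power_space Y \<Gamma>" and ?\<sigma> = "gen_shift Y \<Gamma> \<psi>"
  obtain V where V: "V \<in> cover_iter (power_top Y \<Gamma>) ?\<sigma> \<U> n"
    "\<And>z. z \<in> ?X \<Longrightarrow> \<forall>a\<in>K. z a = x a \<Longrightarrow> z \<in> V"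
    using Suc.IH by blast
  have mem: "(?\<sigma> ^^ n) z \<in> ?X" if "z \<in> ?X" for z
    by (rule funpow_mem[OF gen_shift_mem[OF \<psi>] that])
  obtain U where U: "U \<in> \<U>"
    "\<And>z. z \<in> ?X \<Longrightarrow> \<forall>a\<in>F. z a = (?\<sigma> ^^ n) x a \<Longrightarrow> z \<in> U"
    using local[OF mem[OF x]] by blast
  let ?U = "{z \<in> topspace (power_top Y \<Gamma>). (?\<sigma> ^^ n) z \<in> U}"
  have "V \<inter> ?U \<in> cover_iter (power_top Y \<Gamma>) ?\<sigma> \<U> (Suc n)"
    using V(1) U(1) unfolding cover_iter.simps cover_join_def cover_preimage_def by blast
  moreover have "z \<in> V \<inter> ?U" if z: "z \<in> ?X" "\<forall>a\<in>K. z a = x a" for z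
  proof -
    have "(?\<sigma> ^^ n) z a = (?\<sigma> ^^ n) x a" if "a \<in> F" for a
      using that z(2) orbits[OF that] \<open>F \<subseteq> \<Gamma>\<close>
      by (simp add: funpow_gen_shift[OF \<psi> x] funpow_gen_shift[OF \<psi> z(1)] subsetD)
    then have "(?\<sigma> ^^ n) z \<in> U" using U(2) mem[OF z(1)] by blast
    then show ?thesis using V(2)[OF z] z(1) by simp
  qed
  ultimately show ?case by blast
qed

lemma min_subcover_le_coordinates:
  assumes fin: "finite (carrier Y)" "finite K"
    and sub: "\<And>V. V \<in> \<V> \<Longrightarrow> V \<subseteq> power_space Y \<Gamma>"
    and local: "\<And>x. x \<in> power_space Y \<Gamma> \<Longrightarrow>
      \<exists>V\<in>\<V>. \<forall>z\<in>power_space Y \<Gamma>. (\<forall>a\<in>K. z a = x a) \<longrightarrow> z \<in> V"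
    and "K \<subseteq> \<Gamma>"
  shows "min_subcover (power_top Y \<Gamma>) \<V> \<le> card (\<Pi>\<^sub>E a\<in>K. carrier Y)"
proof -
  let ?X = "power_space Y \<Gamma>"
  let ?P = "(\<lambda>x. restrict x K) ` ?X"
  obtain f where f: "\<And>x. x \<in> ?X \<Longrightarrow> f x \<in> \<V>"
    "\<And>x z. x \<in> ?X \<Longrightarrow> z \<in> ?X \<Longrightarrow> \<forall>a\<in>K. z a = x a \<Longrightarrow> z \<in> f x"
    using local by metis
  \<comment> \<open>One member of the cover is kept for each pattern on \<open>K\<close>.\<close>
  define rep where "rep = inv_into ?X (\<lambda>x. restrict x K)"
  have rep: "rep p \<in> ?X" "restrict (rep p) K = p" if "p \<in> ?P" for p
    using inv_into_into[OF that] f_inv_into_f[OF that] unfolding rep_def by auto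
  let ?\<W> = "(\<lambda>p. f (rep p)) ` ?P"
  have P: "?P \<subseteq> (\<Pi>\<^sub>E a\<in>K. carrier Y)"
    using \<open>K \<subseteq> \<Gamma>\<close> by (auto dest: PiE_mem)
  have finP: "finite (\<Pi>\<^sub>E a\<in>K. carrier Y)" using fin by (intro finite_PiE)
  have "?\<W> \<subseteq> \<V>" using f(1) rep(1) by blast
  moreover have "finite ?\<W>" using finite_subset[OF P finP] by blast
  moreover have "\<Union>?\<W> = topspace (power_top Y \<Gamma>)"
  proof
    show "\<Union>?\<W> \<subseteq> topspace (power_top Y \<Gamma>)"
      using f(1) rep(1) sub by simp blast
    show "topspace (power_top Y \<Gamma>) \<subseteq> \<Union>?\<W>"
    proof
      fix x assume "x \<in> topspace (power_top Y \<Gamma>)"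
      then have x: "x \<in> ?X" by simp
      then have p: "restrict x K \<in> ?P" by blast
      have "\<forall>a\<in>K. x a = rep (restrict x K) a"
        using fun_cong[OF rep(2)[OF p]] by (metis restrict_apply')
      then have "x \<in> f (rep (restrict x K))" by (rule f(2)[OF rep(1)[OF p] x])
      then show "x \<in> \<Union>?\<W>" using p by blast
    qed
  qed
  ultimately have "min_subcover (power_top Y \<Gamma>) \<V> \<le> card ?\<W>"
    unfolding min_subcover_def by (intro Least_le) blast
  also have "\<dots> \<le> card ?P" using finite_subset[OF P finP] by (rule card_image_le)
  also have "\<dots> \<le> card (\<Pi>\<^sub>E a\<in>K. carrier Y)" using finP P by (rule card_mono)
  finally show ?thesis .
qed

text \<open>
  If all \<open>\<psi>\<close>-orbits are finite, then a cover that depends on finitely many coordinates only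
  has all its iterated joins depending on one finite \<open>\<psi>\<close>-invariant set of coordinates.
\<close>
lemma ent_top_gen_shift_le_0:
  assumes \<psi>: "\<psi> \<in> \<Gamma> \<rightarrow> \<Gamma>" and fin: "finite (carrier Y)"
    and ep: "\<And>a. a \<in> \<Gamma> \<Longrightarrow> eventually_periodic_on \<psi> {a}"
  shows "ent_top (power_top Y \<Gamma>) (gen_shift Y \<Gamma> \<psi>) \<le> 0"
  unfolding ent_top_def
proof (rule SUP_least)
  fix \<U> assume "\<U> \<in> {\<U>. finite_open_cover (power_top Y \<Gamma>) \<U>}"
  then have "finite_open_cover (power_top Y \<Gamma>) \<U>" by simp
  then obtain F where F: "finite F" "F \<subseteq> \<Gamma>"
    "\<And>x. x \<in> power_space Y \<Gamma> \<Longrightarrow>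
      \<exists>U\<in>\<U>. \<forall>z\<in>power_space Y \<Gamma>. (\<forall>a\<in>F. z a = x a) \<longrightarrow> z \<in> U"
    by (rule finite_open_cover_power_top[OF fin]) blast
  have "eventually_periodic_on \<psi> F"
    by (rule eventually_periodic_on_finite[OF F(1) ep[OF subsetD[OF F(2)]]])
  then obtain L where L: "\<And>n. \<exists>i<L. \<forall>a\<in>F. (\<psi> ^^ n) a = (\<psi> ^^ i) a"
    using funpow_takes_finitely_many_values by metis
  let ?K = "\<Union>i<L. (\<psi> ^^ i) ` F"
  have K: "(\<psi> ^^ n) a \<in> ?K" if "a \<in> F" for a n
    using L[of n] that by fastforce
  have "finite ?K" using F(1) by blast
  moreover have "?K \<subseteq> \<Gamma>" using funpow_mem[OF \<psi>] F(2) by blast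
  ultimately have "min_subcover (power_top Y \<Gamma>) (cover_iter (power_top Y \<Gamma>) (gen_shift Y \<Gamma> \<psi>) \<U> n)
      \<le> card (\<Pi>\<^sub>E a\<in>?K. carrier Y)" for n
    using cover_iter_subset_topspace[of _ "power_top Y \<Gamma>"]
    by (intro min_subcover_le_coordinates[OF fin]
        cover_iter_invariant_coordinates[OF \<psi> K F(2,3)]) auto
  then show "lim (\<lambda>n. ereal (ln (real (min_subcover (power_top Y \<Gamma>)
      (cover_iter (power_top Y \<Gamma>) (gen_shift Y \<Gamma> \<psi>) \<U> n))) / real n)) \<le> 0"
    by (rule eq_refl[OF lim_ln_over_n_if_bounded])
qed

section \<open>Algebraic entropy of a generalized shift\<close>

text \<open>
  The elements of a finite subgroup of the direct sum have a common finite support; since \<open>\<psi>\<close> has finite fibres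
  and only finitely many different iterates, the images of the subgroup under all iterates of the
  shift, and hence all partial sums of its trajectory, are supported in one finite set.
\<close>
lemma ent_alg_gen_shift_le_0:
  assumes \<psi>: "\<psi> \<in> \<Gamma> \<rightarrow> \<Gamma>" and fib: "finite_fibre \<Gamma> \<psi>"
    and "group Y" and fin: "finite (carrier Y)" and ep: "eventually_periodic_on \<psi> \<Gamma>"
  shows "ent_alg (direct_sum Y \<Gamma>)
    (restrict (gen_shift Y \<Gamma> \<psi>) (carrier (direct_sum Y \<Gamma>))) \<le> 0"
  unfolding ent_alg_def
proof (rule SUP_least)
  interpret Y: group Y by fact
  let ?X = "power_space Y \<Gamma>" and ?\<sigma> = "gen_shift Y \<Gamma> \<psi>" and ?G = "direct_sum Y \<Gamma>"
  let ?\<theta> = "restrict ?\<sigma> (carrier ?G)"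
  fix H assume "H \<in> {H. subgroup H ?G \<and> finite H}"
  then have H: "H \<subseteq> carrier ?G" "finite H" by (auto dest: subgroup.subset)
  have carrier: "carrier ?G = {x \<in> ?X. finite {a \<in> \<Gamma>. x a \<noteq> \<one>\<^bsub>Y\<^esub>}}"
    using \<open>group Y\<close> by (simp add: carrier_sum_group)
  have "?\<sigma> x \<in> carrier ?G" if x: "x \<in> carrier ?G" for x
  proof -
    have X: "x \<in> ?X" and "finite {a \<in> \<Gamma>. x a \<noteq> \<one>\<^bsub>Y\<^esub>}" using x unfolding carrier by auto
    then have "finite {a \<in> \<Gamma>. (\<psi> ^^ 1) a \<in> {a \<in> \<Gamma>. x a \<noteq> \<one>\<^bsub>Y\<^esub>}}"
      by (intro finite_funpow_vimage[OF \<psi> fib])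
    then have "finite {a \<in> \<Gamma>. ?\<sigma> x a \<noteq> \<one>\<^bsub>Y\<^esub>}"
      by (rule rev_finite_subset) (use \<psi> in \<open>auto simp: gen_shift_apply[OF X]\<close>)
    then show ?thesis
      unfolding carrier using funcset_mem[OF gen_shift_mem[OF \<psi>] X] by blast
  qed
  then have \<theta>: "(?\<theta> ^^ n) x = (?\<sigma> ^^ n) x" if "x \<in> carrier ?G" for n x
    using that by (intro funpow_restrict) auto
  obtain L where L: "\<And>n. \<exists>i<L. \<forall>a\<in>\<Gamma>. (\<psi> ^^ n) a = (\<psi> ^^ i) a"
    using funpow_takes_finitely_many_values[OF ep] by metis
  define S where "S = (\<Union>h\<in>H. {a \<in> \<Gamma>. h a \<noteq> \<one>\<^bsub>Y\<^esub>})"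
  define S' where "S' = (\<Union>i<L. {a \<in> \<Gamma>. (\<psi> ^^ i) a \<in> S})"
  define W where "W = {x \<in> ?X. \<forall>a\<in>\<Gamma> - S'. x a = \<one>\<^bsub>Y\<^esub>}"
  have "finite S" using H unfolding S_def carrier by blast
  then have "finite S'"
    unfolding S'_def using finite_funpow_vimage[OF \<psi> fib] by blast
  have "W \<subseteq> (\<lambda>p. \<lambda>a\<in>\<Gamma>. if a \<in> S' then p a else \<one>\<^bsub>Y\<^esub>) ` (\<Pi>\<^sub>E a\<in>S'. carrier Y)"
  proof
    fix x assume x: "x \<in> W"
    then have "x = (\<lambda>a\<in>\<Gamma>. if a \<in> S' then restrict x S' a else \<one>\<^bsub>Y\<^esub>)"
      by (auto simp: W_def PiE_iff extensional_def fun_eq_iff)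
    moreover have "restrict x S' \<in> (\<Pi>\<^sub>E a\<in>S'. carrier Y)"
      using x by (auto simp: W_def S'_def dest: PiE_mem)
    ultimately show "x \<in> (\<lambda>p. \<lambda>a\<in>\<Gamma>. if a \<in> S' then p a else \<one>\<^bsub>Y\<^esub>) ` (\<Pi>\<^sub>E a\<in>S'. carrier Y)"
      by blast
  qed
  then have finW: "finite W"
    by (rule finite_subset) (use \<open>finite S'\<close> fin in \<open>intro finite_imageI finite_PiE\<close>)
  have iterates: "(?\<theta> ^^ n) h \<in> W" if "h \<in> H" for h n
  proof -
    have hG: "h \<in> carrier ?G" and hX: "h \<in> ?X" using H(1) that unfolding carrier by auto
    obtain i where i: "i < L" "\<forall>a\<in>\<Gamma>. (\<psi> ^^ n) a = (\<psi> ^^ i) a" using L by blast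
    have "h ((\<psi> ^^ n) a) = \<one>\<^bsub>Y\<^esub>" if "a \<in> \<Gamma> - S'" for a
      using that i funpow_mem[OF \<psi>, of a i] \<open>h \<in> H\<close> unfolding S'_def S_def by auto
    then show ?thesis
      using funpow_mem[OF gen_shift_mem[OF \<psi>] hX, of n]
      unfolding W_def \<theta>[OF hG] by (simp add: funpow_gen_shift[OF \<psi> hX])
  qed
  have "alg_traj ?G ?\<theta> H n \<subseteq> W" for n
  proof (induction n)
    case 0
    show ?case by (auto simp: W_def)
  next
    case (Suc n)
    have mult: "(\<lambda>a\<in>\<Gamma>. x a \<otimes>\<^bsub>Y\<^esub> y a) \<in> W" if "x \<in> W" "y \<in> W" for x y
      using that by (auto simp: W_def dest: PiE_mem)
    show ?case
    proof
      fix z assume "z \<in> alg_traj ?G ?\<theta> H (Suc n)"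
      then obtain x y where "x \<in> alg_traj ?G ?\<theta> H n" "y \<in> (?\<theta> ^^ n) ` H"
        "z = (\<lambda>a\<in>\<Gamma>. x a \<otimes>\<^bsub>Y\<^esub> y a)"
        by (auto simp: set_mult_def)
      then show "z \<in> W" using mult Suc iterates by blast
    qed
  qed
  then have "card (alg_traj ?G ?\<theta> H n) \<le> card W" for n
    using finW by (intro card_mono)
  then show "lim (\<lambda>n. ereal (ln (real (card (alg_traj ?G ?\<theta> H n))) / real n)) \<le> 0"
    by (rule eq_refl[OF lim_ln_over_n_if_bounded])
qed

section \<open>Comparison of the entropies\<close>

text \<open>
  The first inequality is decided by whether all \<open>\<psi>\<close>-orbits are finite, the other two by whether
  \<open>\<psi>\<close> is eventually periodic on the whole of \<open>\<Gamma>\<close>. The second condition is stronger: it asks for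
  preperiods and periods that are bounded uniformly in the index.
\<close>
lemma entropies_gen_shift:
  assumes "(Y, \<Gamma>, \<sigma>) \<in> shifts"
  shows "ent_top (power_top Y \<Gamma>) \<sigma> \<le> ent_cset (power_space Y \<Gamma>) \<sigma>"
    and "ent_cset (power_space Y \<Gamma>) \<sigma> \<le> ent_set (power_space Y \<Gamma>) \<sigma>"
    and "ent_alg (direct_sum Y \<Gamma>) (restrict \<sigma> (carrier (direct_sum Y \<Gamma>)))
      \<le> ent_set (power_space Y \<Gamma>) \<sigma>"
proof -
  obtain \<psi> where \<sigma>: "\<sigma> = gen_shift Y \<Gamma> \<psi>" and Y: "group Y" "finite (carrier Y)" "\<not> trivial_group Y"
    and \<psi>: "\<psi> \<in> \<Gamma> \<rightarrow> \<Gamma>" "finite_fibre \<Gamma> \<psi>" "finite_fibre (power_space Y \<Gamma>) (gen_shift Y \<Gamma> \<psi>)"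
    using assms unfolding shifts_def by auto
  obtain g where g: "g \<in> carrier Y" "g \<noteq> \<one>\<^bsub>Y\<^esub>"
    using Y(1,3) monoid.one_closed[OF group.is_monoid[OF Y(1)]] unfolding trivial_group_def by blast
  show "ent_top (power_top Y \<Gamma>) \<sigma> \<le> ent_cset (power_space Y \<Gamma>) \<sigma>"
  proof (cases "\<forall>a\<in>\<Gamma>. eventually_periodic_on \<psi> {a}")
    case True
    then have "ent_top (power_top Y \<Gamma>) \<sigma> \<le> 0"
      unfolding \<sigma> by (intro ent_top_gen_shift_le_0[OF \<psi>(1) Y(2)]) blast
    then show ?thesis using ent_cset_nonneg order_trans by blast
  next
    case False
    then show ?thesis
      using ent_cset_gen_shift_eq_infinity[OF \<psi>(1) Y(1) g \<psi>(3)] unfolding \<sigma> by fastforce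
  qed
  have "ent_cset (power_space Y \<Gamma>) \<sigma> \<le> ent_set (power_space Y \<Gamma>) \<sigma> \<and>
    ent_alg (direct_sum Y \<Gamma>) (restrict \<sigma> (carrier (direct_sum Y \<Gamma>))) \<le> ent_set (power_space Y \<Gamma>) \<sigma>"
  proof (cases "eventually_periodic_on \<psi> \<Gamma>")
    case True
    show ?thesis
      unfolding \<sigma> ent_cset_gen_shift_eq_0[OF \<psi>(1) Y(1) True]
      by (intro conjI ent_set_nonneg order_trans[OF ent_alg_gen_shift_le_0[OF \<psi>(1,2) Y(1,2) True]])
  next
    case False
    then show ?thesis
      using ent_set_gen_shift_eq_infinity[OF \<psi>(1,2) Y(1) g] unfolding \<sigma> by simp
  qed
  then show "ent_cset (power_space Y \<Gamma>) \<sigma> \<le> ent_set (power_space Y \<Gamma>) \<sigma>"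
    "ent_alg (direct_sum Y \<Gamma>) (restrict \<sigma> (carrier (direct_sum Y \<Gamma>))) \<le> ent_set (power_space Y \<Gamma>) \<sigma>"
    by blast+
qed

theorem lemma4p3:
  shows "(shifts_top :: ('a, 'i) shift set) \<subseteq> shifts_cset \<and>
    (shifts_cset :: ('a, 'i) shift set) \<subseteq> shifts_set \<and>
    (shifts_dalg :: ('a, 'i) shift set) \<subseteq> shifts_set \<and>
    (\<forall>(Y, \<Gamma>, \<sigma>) \<in> (shifts :: ('a, 'i) shift set).
      ent_top (power_top Y \<Gamma>) \<sigma> \<le> ent_cset (power_space Y \<Gamma>) \<sigma> \<and>
      ent_cset (power_space Y \<Gamma>) \<sigma> \<le> ent_set (power_space Y \<Gamma>) \<sigma> \<and>
      (comm_group Y \<longrightarrow>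
        ent_alg (direct_sum Y \<Gamma>) (restrict \<sigma> (carrier (direct_sum Y \<Gamma>)))
          \<le> ent_set (power_space Y \<Gamma>) \<sigma>))"
proof (intro conjI)
  show "(shifts_top :: ('a, 'i) shift set) \<subseteq> shifts_cset"
    unfolding shifts_top_def shifts_cset_def by (auto intro: less_le_trans entropies_gen_shift(1))
  show "(shifts_cset :: ('a, 'i) shift set) \<subseteq> shifts_set"
    unfolding shifts_cset_def shifts_set_def by (auto intro: less_le_trans entropies_gen_shift(2))
  show "(shifts_dalg :: ('a, 'i) shift set) \<subseteq> shifts_set"
    unfolding shifts_dalg_def shifts_set_def by (auto intro: less_le_trans entropies_gen_shift(3))
qed (auto intro: entropies_gen_shift)

end
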